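(* Let $t\geq 3$ and $\beta=2^{t-1}$. For every integer $l$ with $t+1\leq l\leq 2t$ there exist two quaternary linear perfect codes $\mathcal{C}_1,\mathcal{C}_2\subseteq\mathbb{Z}_4^{\beta}$ of length $\beta$ such that $\eta(\mathcal{C}_1,\mathcal{C}_2)=|\mathcal{C}_1\cap\mathcal{C}_2|=2^{2\beta-l}$.
   Context: A quaternary linear code of length $\beta$ is a subgroup $\mathcal{C}$ of $\mathbb{Z}_4^{\beta}$. Its dual is $\mathcal{C}^\perp=\{u\in\mathbb{Z}_4^\beta:\sum_j u_jv_j=0\in\mathbb{Z}_4 \text{ for all } v\in\mathcal{C}\}$. The Gray map $\phi:\mathbb{Z}_4^{\beta}\to\mathbb{Z}_2^{2\beta}$ applies coordinatewise $0\mapsto(0,0),\ 1\mapsto(0,1),\ 2\mapsto(1,1),\ 3\mapsto(1,0)$. A quaternary linear perfect code of length $\beta=2^{t-1}$ is a quaternary linear code $\mathcal{C}\subseteq\mathbb{Z}_4^\beta$ such that $\phi(\mathcal{C})$ has the parameters of an extended perfect binary code: length $2^t$, $2^{2^t-t-1}$ codewords, minimum Hamming distance $4$. Standing convention: the all-ones vector $(1,\ldots,1)\in\mathbb{Z}_4^\beta$ belongs to $\mathcal{C}^\perp$ for every quaternary linear perfect code $\mathcal{C}$ (codes are considered up to coordinate permutation, not sign changes). *)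

theory Defs
  imports "HOL-Algebra.Product_Groups" "HOL-Algebra.Elementary_Groups"
begin

text \<open>Vectors of length \<open>n\<close> over the residues \<open>{0..<int m}\<close> modulo \<open>m > 0\<close>; coordinates are
  numbered from \<open>0\<close>, and vectors are \<open>undefined\<close> outside \<open>{..<n}\<close>.\<close>

definition Z_vec :: "nat \<Rightarrow> nat \<Rightarrow> (nat \<Rightarrow> int) monoid" where
  "Z_vec m n = product_group {..<n} (\<lambda>_. integer_mod_group m)"

definition quaternary_linear_code :: "nat \<Rightarrow> (nat \<Rightarrow> int) set \<Rightarrow> bool" where
  "quaternary_linear_code n C \<longleftrightarrow> subgroup C (Z_vec 4 n)"

definition quaternary_dual :: "nat \<Rightarrow> (nat \<Rightarrow> int) set \<Rightarrow> (nat \<Rightarrow> int) set" where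
  "quaternary_dual n C = {u \<in> carrier (Z_vec 4 n). \<forall>v\<in>C. (\<Sum>j<n. u j * v j) mod 4 = 0}"

text \<open>Only the arguments \<open>0\<close>, \<open>1\<close>, \<open>2\<close>, \<open>3\<close> matter; the last branch is the argument \<open>3\<close>.\<close>

definition gray_symbol :: "int \<Rightarrow> int \<times> int" where
  "gray_symbol a =
     (if a = 0 then (0, 0) else if a = 1 then (0, 1) else if a = 2 then (1, 1) else (1, 0))"

text \<open>Coordinate \<open>j\<close> of \<open>x\<close> yields the coordinates \<open>2 * j\<close> and \<open>2 * j + 1\<close> of the image.\<close>

definition gray_map :: "nat \<Rightarrow> (nat \<Rightarrow> int) \<Rightarrow> (nat \<Rightarrow> int)" where
  "gray_map n x = (\<lambda>i\<in>{..<2 * n}.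
     if even i then fst (gray_symbol (x (i div 2))) else snd (gray_symbol (x (i div 2))))"

definition hamming_dist :: "nat \<Rightarrow> (nat \<Rightarrow> int) \<Rightarrow> (nat \<Rightarrow> int) \<Rightarrow> nat" where
  "hamming_dist n x y = card {i. i < n \<and> x i \<noteq> y i}"

definition min_distance :: "nat \<Rightarrow> (nat \<Rightarrow> int) set \<Rightarrow> nat" where
  "min_distance n D = Min {hamming_dist n x y | x y. x \<in> D \<and> y \<in> D \<and> x \<noteq> y}"

definition extended_perfect_parameters :: "nat \<Rightarrow> (nat \<Rightarrow> int) set \<Rightarrow> bool" where
  "extended_perfect_parameters t D \<longleftrightarrow>
     D \<subseteq> carrier (Z_vec 2 (2 ^ t)) \<and>
     card D = 2 ^ (2 ^ t - t - 1) \<and>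
     min_distance (2 ^ t) D = 4"

text \<open>For \<open>t > 0\<close>; the length is \<open>2 ^ (t - 1)\<close>. The last conjunct is a normalization: it selects,
  among codes that differ by sign changes of coordinates, those orthogonal to the all-ones vector.\<close>

definition quaternary_linear_perfect_code :: "nat \<Rightarrow> (nat \<Rightarrow> int) set \<Rightarrow> bool" where
  "quaternary_linear_perfect_code t C \<longleftrightarrow>
     quaternary_linear_code (2 ^ (t - 1)) C \<and>
     extended_perfect_parameters t (gray_map (2 ^ (t - 1)) ` C) \<and>
     (\<lambda>j\<in>{..<2 ^ (t - 1)}. 1) \<in> quaternary_dual (2 ^ (t - 1)) C"

definition intersection_number :: "(nat \<Rightarrow> int) set \<Rightarrow> (nat \<Rightarrow> int) set \<Rightarrow> nat" where
  "intersection_number C\<^sub>1 C\<^sub>2 = card (C\<^sub>1 \<inter> C\<^sub>2)"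

end

theory Submission
  imports Defs "HOL-Number_Theory.Cong" "HOL-Combinatorics.Permutations"
begin

text \<open>A quaternary linear perfect code is the kernel of a matrix whose first row is all ones and
  whose columns, apart from the first entry, run once through an abelian group \<open>A\<close> of order \<open>\<beta>\<close> and
  exponent at most 4; the intersection of two such codes is the kernel of the stacked matrix, and its
  size is determined by the size of the row module.  For \<open>t \<ge> 4\<close> take \<open>A = \<int>\<^sub>2\<^sup>t\<^sup>-\<^sup>1\<close> and list its
  elements once in the natural order and once permuted by the cycle \<open>(0 e\<^sub>0 e\<^sub>1 \<dots> e\<^sub>s\<^sub>-\<^sub>1)\<close>, which
  gives \<open>l = t + 1 + s\<close>: the points of weight at least 2 are fixed and span affinely, while the
  displacements on the cycle have rank \<open>s\<close>.  For \<open>t = 3\<close> every permutation of \<open>\<int>\<^sub>2\<^sup>2\<close> is affine, so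
  \<open>A = \<int>\<^sub>4\<close> is used for at least one of the two codes when \<open>l > 4\<close>.\<close>

section \<open>Codes given by parity checks\<close>

lemma carrier_Z_vec:
  assumes "m > 0"
  shows "carrier (Z_vec m n) = {..<n} \<rightarrow>\<^sub>E {0..<int m}"
  using assms by (simp add: Z_vec_def carrier_integer_mod_group)

text \<open>Check rows may be arbitrary integer functions: only their values below \<open>n\<close>,
  read modulo 4, affect the sums. So rows such as \<open>\<lambda>_. 1\<close> need no restriction
  or reduction.\<close>

lemma mem_dual_iff:
  "u \<in> quaternary_dual n R \<longleftrightarrow>
     u \<in> {..<n} \<rightarrow>\<^sub>E {0..<4} \<and> (\<forall>r\<in>R. 4 dvd (\<Sum>j<n. u j * r j))"
  by (simp add: quaternary_dual_def carrier_Z_vec dvd_eq_mod_eq_0)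

lemma finite_dual: "finite (quaternary_dual n R)"
proof (rule finite_subset)
  show "quaternary_dual n R \<subseteq> {..<n} \<rightarrow>\<^sub>E {0..<4}" by (simp add: subset_iff mem_dual_iff)
qed (simp add: finite_PiE)

text \<open>This turns the intersection of two codes into a single kernel, whose size can be found
  one check row at a time.\<close>

lemma dual_Un: "quaternary_dual n (R \<union> S) = quaternary_dual n R \<inter> quaternary_dual n S"
  unfolding quaternary_dual_def by blast

lemma card_dual_empty: "card (quaternary_dual n {}) = 4 ^ n"
proof -
  have "quaternary_dual n {} = {..<n} \<rightarrow>\<^sub>E {0..<4}"
    by (simp add: set_eq_iff mem_dual_iff)
  then show ?thesis by (simp add: card_PiE)
qed

lemma sum_reduced_cong:
  "[(\<Sum>j<n. (\<lambda>j\<in>{..<n}. f j mod 4) j * r j) = (\<Sum>j<n. f j * r j :: int)] (mod 4)"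
  by (rule cong_sum) (simp only: restrict_apply cong_def mod_mult_left_eq if_True)

lemma dvd_sum_reduced_iff:
  "(4::int) dvd (\<Sum>j<n. (\<lambda>j\<in>{..<n}. f j mod 4) j * r j) \<longleftrightarrow> 4 dvd (\<Sum>j<n. f j * r j)"
  by (rule cong_dvd_iff[OF sum_reduced_cong])

text \<open>Integer combinations of vectors must be reduced to lie in the carrier; membership can
  still be tested on the unreduced values.\<close>

lemma reduced_mem_dual_iff:
  "(\<lambda>j\<in>{..<n}. f j mod 4) \<in> quaternary_dual n R \<longleftrightarrow> (\<forall>r\<in>R. 4 dvd (\<Sum>j<n. f j * r j))"
proof -
  have "(\<lambda>j\<in>{..<n}. f j mod 4) \<in> {..<n} \<rightarrow>\<^sub>E {0..<4}" by auto
  then show ?thesis by (simp only: mem_dual_iff dvd_sum_reduced_iff simp_thms)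
qed

text \<open>The vector \<open>w\<close> represents a generator of the image \<open>g \<int>\<^sub>4\<close> of the functional \<open>r\<close>; the index of
  the kernel is therefore \<open>q = 4 / g\<close>.\<close>

lemma card_dual_insert:
  fixes g q :: nat
  assumes gq: "g * q = 4"
    and r: "\<And>j. j < n \<Longrightarrow> int g dvd r j"
    and w: "\<And>s. s \<in> R \<Longrightarrow> 4 dvd (\<Sum>j<n. w j * s j)"
    and wr: "[(\<Sum>j<n. w j * r j) = int g] (mod 4)"
  shows "card (quaternary_dual n (insert r R)) * q = card (quaternary_dual n R)"
proof -
  let ?K = "quaternary_dual n R" and ?L = "quaternary_dual n (insert r R)"
  let ?f = "\<lambda>(u, a) j. u j + int a * w j :: int"
  \<comment> \<open>Coset decomposition: every element of \<open>?K\<close> is uniquely an element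
    of \<open>?L\<close> plus \<open>a\<close> copies of \<open>w\<close> with
    \<open>a < q\<close>.\<close>
  let ?F = "\<lambda>p. \<lambda>j\<in>{..<n}. ?f p j mod 4"
  have g0: "int g > 0" "q > 0" using gq by (auto intro!: Nat.gr0I)
  have sum_f: "(\<Sum>j<n. ?f (u, a) j * s j) = (\<Sum>j<n. u j * s j) + int a * (\<Sum>j<n. w j * s j)" for u a s
    by (simp add: distrib_right sum.distrib sum_distrib_left mult.assoc)
  have "bij_betw ?F (?L \<times> {..<q}) ?K"
  proof (rule bij_betw_imageI)
    show "inj_on ?F (?L \<times> {..<q})"
    proof (rule inj_onI)
      fix p p'
      assume "p \<in> ?L \<times> {..<q}" "p' \<in> ?L \<times> {..<q}" and eq': "?F p = ?F p'"
      then obtain u a v b where p: "p = (u, a)" "p' = (v, b)"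
        and u: "u \<in> ?L" and v: "v \<in> ?L" and a: "a < q" and b: "b < q" by blast
      have eq: "?F (u, a) = ?F (v, b)" using eq' unfolding p .
      \<comment> \<open>The syndrome at \<open>r\<close> recovers \<open>a\<close>, because elements
        of \<open>?L\<close> contribute 0 to it.\<close>
      have syn: "[(\<Sum>j<n. ?F (u, a) j * r j) = int a * int g] (mod 4)" if "u \<in> ?L" for u a
      proof -
        have "[(\<Sum>j<n. ?F (u, a) j * r j) = (\<Sum>j<n. u j * r j) + int a * (\<Sum>j<n. w j * r j)] (mod 4)"
          using sum_reduced_cong[where n = n and f = "?f (u, a)" and r = r] unfolding sum_f .
        also have "[(\<Sum>j<n. u j * r j) + int a * (\<Sum>j<n. w j * r j) = 0 + int a * int g] (mod 4)"
          using that wr by (intro cong_add cong_mult) (auto simp: mem_dual_iff cong_0_iff)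
        finally show ?thesis by simp
      qed
      have "[int a * int g = int b * int g] (mod 4)"
        using cong_trans[OF cong_sym[OF syn[OF u, of a]] syn[OF v, of b, folded eq]] .
      then have "[a * g = b * g] (mod 4)"
        by (simp flip: of_nat_mult cong_int_iff)
      moreover have "a * g < q * g" "b * g < q * g" using a b g0 by simp_all
      then have "a * g < 4" "b * g < 4" using gq by (simp_all add: mult.commute)
      ultimately have "a * g = b * g" by (simp add: cong_def)
      then have ab: "a = b" using g0 by simp
      have "u j = v j" for j
      proof (cases "j < n")
        case True
        have "[u j + int a * w j = v j + int a * w j] (mod 4)"
          using fun_cong[OF eq, of j] True ab by (simp add: cong_def)
        then have "[u j = v j] (mod 4)" by (simp only: cong_add_rcancel)
        moreover have "u j \<in> {0..<4}" "v j \<in> {0..<4}"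
          using u v True by (auto simp: mem_dual_iff)
        ultimately show ?thesis by (simp add: cong_def)
      next
        case False
        then show ?thesis using u v by (auto simp: mem_dual_iff PiE_iff extensional_def)
      qed
      then show "p = p'" using ab p by auto
    qed
    show "?F ` (?L \<times> {..<q}) = ?K"
    proof (intro equalityI subsetI)
      fix x assume "x \<in> ?F ` (?L \<times> {..<q})"
      then obtain u a where x: "x = ?F (u, a)" and u: "u \<in> ?L" by auto
      show "x \<in> ?K"
        unfolding x reduced_mem_dual_iff sum_f
      proof
        fix s assume "s \<in> R"
        then have "4 dvd (\<Sum>j<n. u j * s j)" "4 dvd (\<Sum>j<n. w j * s j)"
          using u w by (simp_all add: mem_dual_iff)
        then show "4 dvd (\<Sum>j<n. u j * s j) + int a * (\<Sum>j<n. w j * s j)" by simp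
      qed
    next
      fix x assume x: "x \<in> ?K"
      define S where "S = (\<Sum>j<n. x j * r j)"
      have "int g dvd S" unfolding S_def using r by (auto intro!: dvd_sum)
      then obtain c where c: "S = int g * c" by auto
      \<comment> \<open>Subtracting \<open>a\<close> copies of \<open>w\<close> kills the syndrome
        \<open>S\<close>; only \<open>c\<close> modulo \<open>q\<close> matters, because
        \<open>g * q = 4\<close>.\<close>
      define a where "a = nat (c mod int q)"
      have a: "a < q" "int a = c mod int q" using g0 by (auto simp: a_def nat_less_iff)
      have "4 = int g * int q" using arg_cong[OF gq, of int] by simp
      then have "S mod 4 = int a * int g"
        unfolding c a by (simp only: mult_mod_right mult.commute[of "c mod int q"])
      then have Sa: "[S = int a * int g] (mod 4)" by (metis cong_mod_right cong_refl)
      define u where "u = (\<lambda>j\<in>{..<n}. (x j - int a * w j) mod 4)"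
      have sumu: "(\<Sum>j<n. (x j - int a * w j) * s j) = (\<Sum>j<n. x j * s j) - int a * (\<Sum>j<n. w j * s j)" for s
        by (simp add: left_diff_distrib sum_subtractf sum_distrib_left mult.assoc)
      have "[S - int a * (\<Sum>j<n. w j * r j) = int a * int g - int a * int g] (mod 4)"
        using Sa wr by (intro cong_diff cong_mult) auto
      then have "4 dvd S - int a * (\<Sum>j<n. w j * r j)"
        by (simp only: diff_self cong_0_iff)
      then have "u \<in> ?L"
        unfolding u_def reduced_mem_dual_iff sumu using x w
        by (simp add: mem_dual_iff S_def)
      moreover have "x = ?F (u, a)"
      proof
        fix j
        show "x j = ?F (u, a) j"
        proof (cases "j < n")
          case True
          then have "x j \<in> {0..<4}" using x by (auto simp: mem_dual_iff)
          then have "x j = (x j - int a * w j + int a * w j) mod 4" by simp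
          then show ?thesis using True by (simp add: u_def mod_add_left_eq del: diff_add_cancel)
        next
          case False
          then show ?thesis using x by (auto simp: mem_dual_iff PiE_iff extensional_def)
        qed
      qed
      ultimately show "x \<in> ?F ` (?L \<times> {..<q})"
        using a by (intro image_eqI[of _ _ "(u, a)"]) simp_all
    qed
  qed
  from bij_betw_same_card[OF this] show ?thesis by (simp only: card_cartesian_product card_lessThan)
qed

lemma subgroup_dual: "quaternary_linear_code n (quaternary_dual n R)"
  unfolding quaternary_linear_code_def
proof (rule group.subgroupI)
  let ?K = "quaternary_dual n R"
  have car: "carrier (Z_vec 4 n) = {..<n} \<rightarrow>\<^sub>E {0..<4}" by (simp add: carrier_Z_vec)
  show "group (Z_vec 4 n)" by (simp add: Z_vec_def)
  show "?K \<subseteq> carrier (Z_vec 4 n)" by (auto simp: quaternary_dual_def)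
  \<comment> \<open>The zero vector is written as a reduction so that
    \<open>reduced_mem_dual_iff\<close> matches.\<close>
  have "(\<lambda>j\<in>{..<n}. 0 mod 4) \<in> ?K" unfolding reduced_mem_dual_iff by simp
  then show "?K \<noteq> {}" by blast
  fix u assume u: "u \<in> ?K"
  have "inv\<^bsub>Z_vec 4 n\<^esub> u = (\<lambda>j\<in>{..<n}. (- u j) mod 4)"
  proof -
    have "u \<in> (\<Pi>\<^sub>E j\<in>{..<n}. carrier (integer_mod_group 4))"
      using u by (simp add: mem_dual_iff carrier_integer_mod_group)
    then have "inv\<^bsub>Z_vec 4 n\<^esub> u = (\<lambda>j\<in>{..<n}. inv\<^bsub>integer_mod_group 4\<^esub> u j)"
      unfolding Z_vec_def by (intro inv_product_group) auto
    also have "\<dots> = (\<lambda>j\<in>{..<n}. (- u j) mod 4)"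
      using u by (intro restrict_ext) (simp add: mem_dual_iff PiE_iff inv_integer_mod_group carrier_integer_mod_group)
    finally show ?thesis .
  qed
  then show "inv\<^bsub>Z_vec 4 n\<^esub> u \<in> ?K"
    using u by (simp only: reduced_mem_dual_iff) (simp add: mem_dual_iff sum_negf)
  fix v assume v: "v \<in> ?K"
  have "u \<otimes>\<^bsub>Z_vec 4 n\<^esub> v = (\<lambda>j\<in>{..<n}. (u j + v j) mod 4)"
    by (simp add: Z_vec_def mult_integer_mod_group)
  then show "u \<otimes>\<^bsub>Z_vec 4 n\<^esub> v \<in> ?K"
    using u v by (simp only: reduced_mem_dual_iff) (simp add: mem_dual_iff distrib_right sum.distrib)
qed

section \<open>Lee distance and perfect codes\<close>

definition lee_dist :: "int \<Rightarrow> int \<Rightarrow> nat" where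
  "lee_dist a b = (if (a - b) mod 4 = 0 then 0 else if (a - b) mod 4 = 2 then 2 else 1)"

lemma int_cases_0_3:
  fixes a :: int
  assumes "a \<in> {0..<4}"
  obtains "a = 0" | "a = 1" | "a = 2" | "a = 3"
proof -
  have "a = 0 \<or> a = 1 \<or> a = 2 \<or> a = 3" using assms unfolding atLeastLessThan_iff by arith
  then show ?thesis using that by blast
qed

text \<open>The Gray map carries the 4-cycle isometrically onto the square of binary pairs; sixteen
  cases confirm it.\<close>

lemma gray_symbol_dist:
  assumes "a \<in> {0..<4}" "b \<in> {0..<4}"
  shows "of_bool (fst (gray_symbol a) \<noteq> fst (gray_symbol b)) +
    of_bool (snd (gray_symbol a) \<noteq> snd (gray_symbol b)) = lee_dist a b"
  using assms(1)
  by (cases rule: int_cases_0_3; use assms(2) in \<open>cases rule: int_cases_0_3\<close>)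
    (simp_all add: gray_symbol_def lee_dist_def)

lemma card_filter_less_double:
  fixes n :: nat
  shows
  "card {i. i < 2 * n \<and> P i} = (\<Sum>j<n. of_bool (P (2 * j)) + of_bool (P (2 * j + 1)))"
proof -
  have "card {i. i < 2 * n \<and> P i} = (\<Sum>i<2 * n. of_bool (P i))"
    by (simp add: sum_of_bool_eq Int_def)
  also have "\<dots> = (\<Sum>j<n. of_bool (P (2 * j)) + of_bool (P (2 * j + 1)))"
    by (induction n) simp_all
  finally show ?thesis .
qed

lemma hamming_dist_gray:
  assumes "x \<in> {..<n} \<rightarrow>\<^sub>E {0..<4}" "y \<in> {..<n} \<rightarrow>\<^sub>E {0..<4}"
  shows "hamming_dist (2 * n) (gray_map n x) (gray_map n y) = (\<Sum>j<n. lee_dist (x j) (y j))"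
  unfolding hamming_dist_def card_filter_less_double
proof (rule sum.cong)
  fix j assume j: "j \<in> {..<n}"
  then have "x j \<in> {0..<4}" "y j \<in> {0..<4}" using assms by (meson PiE_mem)+
  then show "of_bool (gray_map n x (2 * j) \<noteq> gray_map n y (2 * j)) +
      of_bool (gray_map n x (2 * j + 1) \<noteq> gray_map n y (2 * j + 1)) = lee_dist (x j) (y j)"
    using j gray_symbol_dist[of "x j" "y j"] by (simp add: gray_map_def)
qed simp

lemma lee_dist_eq_0_iff:
  assumes "a \<in> {0..<4}" "b \<in> {0..<4}"
  shows "lee_dist a b = 0 \<longleftrightarrow> a = b"
  using assms(1)
  by (cases rule: int_cases_0_3; use assms(2) in \<open>cases rule: int_cases_0_3\<close>)
    (simp_all add: lee_dist_def)

lemma lee_dist_parity: "even (int (lee_dist a b)) \<longleftrightarrow> even (a - b)"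
  unfolding lee_dist_def by simp presburger

text \<open>Isometries are injective: equal images force every coordinate's Lee distance to
  vanish.\<close>

lemma inj_on_gray_map: "inj_on (gray_map n) ({..<n} \<rightarrow>\<^sub>E {0..<4})"
proof (rule inj_onI)
  fix x y :: "nat \<Rightarrow> int"
  assume x: "x \<in> {..<n} \<rightarrow>\<^sub>E {0..<4}" and y: "y \<in> {..<n} \<rightarrow>\<^sub>E {0..<4}"
    and eq: "gray_map n x = gray_map n y"
  have "(\<Sum>j<n. lee_dist (x j) (y j)) = 0"
    unfolding hamming_dist_gray[OF x y, symmetric] eq by (simp add: hamming_dist_def)
  then have "lee_dist (x j) (y j) = 0" if "j < n" for j using that by simp
  then have "x j = y j" if "j < n" for j
    using that x y lee_dist_eq_0_iff[of "x j" "y j"] by (meson PiE_mem lessThan_iff)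
  with x y show "x = y" by (intro PiE_ext[of x "{..<n}" _ y]) auto
qed

lemma gray_map_in_carrier: "gray_map n x \<in> carrier (Z_vec 2 (2 * n))"
  by (simp add: carrier_Z_vec gray_map_def gray_symbol_def)

text \<open>A nonzero difference \<open>x - y\<close> of Lee weight below 4 has even weight, since its entries sum to 0;
  so it is \<open>2 e\<^sub>a\<close>, excluded by the all-ones row, or \<open>\<plusminus> (e\<^sub>a - e\<^sub>b)\<close>, excluded because the columns
  \<open>a\<close> and \<open>b\<close> differ.\<close>

lemma lee_dist_dual_ge:
  assumes x: "x \<in> quaternary_dual n R" and y: "y \<in> quaternary_dual n R" and "x \<noteq> y"
    and ones: "(\<lambda>_. 1) \<in> R"
    and sep: "\<And>a b. a < n \<Longrightarrow> b < n \<Longrightarrow> a \<noteq> b \<Longrightarrow> \<exists>r\<in>R. \<not> [r a = r b] (mod 4)"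
  shows "4 \<le> (\<Sum>j<n. lee_dist (x j) (y j))"
proof (rule ccontr)
  let ?d = "\<lambda>j. lee_dist (x j) (y j)"
  assume "\<not> 4 \<le> sum ?d {..<n}"
  then have lt: "sum ?d {..<n} < 4" by simp
  have xy: "x \<in> {..<n} \<rightarrow>\<^sub>E {0..<4}" "y \<in> {..<n} \<rightarrow>\<^sub>E {0..<4}" using x y by (auto simp: mem_dual_iff)
  have diff: "4 dvd (\<Sum>j<n. (x j - y j) * r j)" if "r \<in> R" for r
    using x y that by (simp add: left_diff_distrib sum_subtractf mem_dual_iff)
  have diff1: "4 dvd (\<Sum>j<n. x j - y j)" using diff[OF ones] by simp
  have d0: "x j = y j" if "j < n" "?d j = 0" for j
    using that xy lee_dist_eq_0_iff[of "x j" "y j"] by (meson PiE_mem lessThan_iff)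
  \<comment> \<open>Coordinatewise, Lee distance and difference have the same parity, so the
    all-ones check makes the total distance even.\<close>
  have "even (int (sum ?d {..<n}) - (\<Sum>j<n. x j - y j))"
    unfolding of_nat_sum sum_subtractf[symmetric]
    by (intro dvd_sum) (use lee_dist_parity in \<open>auto simp: even_diff_iff\<close>)
  moreover have "even (\<Sum>j<n. x j - y j)" using diff1 dvd_trans[of 2 4] by force
  ultimately have ev: "even (sum ?d {..<n})" by (simp del: of_nat_sum)
  obtain a where a: "a < n" "x a \<noteq> y a"
    using \<open>x \<noteq> y\<close> PiE_ext[OF xy] by blast
  have da: "?d a \<noteq> 0" using a xy lee_dist_eq_0_iff[of "x a" "y a"] by (meson PiE_mem lessThan_iff)
  have split_a: "sum f {..<n} = f a + sum f ({..<n} - {a})" for f :: "nat \<Rightarrow> 'c::comm_monoid_add"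
    using a by (intro sum.remove) auto
  show False
  proof (cases "sum ?d ({..<n} - {a}) = 0")
    case True
    then have "x j = y j" if "j < n" "j \<noteq> a" for j using that d0 by simp
    then have "(\<Sum>j<n. x j - y j) = x a - y a" by (simp add: split_a)
    then have "?d a = 0" using diff1 by (simp add: lee_dist_def dvd_eq_mod_eq_0)
    then show False using da by simp
  next
    case False
    then obtain b where b: "b < n" "b \<noteq> a" "?d b \<noteq> 0" by (auto simp: sum_eq_0_iff)
    have split_b: "sum f {..<n} = f a + (f b + sum f ({..<n} - {a} - {b}))"
      for f :: "nat \<Rightarrow> 'c::comm_monoid_add"
      unfolding split_a using b by (subst sum.remove[of "{..<n} - {a}" b]) auto
    have le: "?d a + (?d b + sum ?d ({..<n} - {a} - {b})) < 4" and
      ev': "even (?d a + (?d b + sum ?d ({..<n} - {a} - {b})))"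
      using lt ev unfolding split_b by auto
    \<comment> \<open>An even total below 4 with two nonzero terms must be 1 + 1.\<close>
    then have one: "?d a = 1" "?d b = 1" and zero: "sum ?d ({..<n} - {a} - {b}) = 0"
      using da b(3) by presburger+
    have "x j = y j" if "j < n" "j \<noteq> a" "j \<noteq> b" for j using that d0 zero by simp
    then have *: "(\<Sum>j<n. (x j - y j) * r j) = (x a - y a) * r a + (x b - y b) * r b" for r
      by (simp add: split_b)
    obtain r where r: "r \<in> R" "\<not> [r a = r b] (mod 4)" using sep a b by metis
    have "4 dvd (x a - y a) + (x b - y b)" using diff[OF ones] unfolding * by simp
    moreover have "4 dvd (x a - y a) * r a + (x b - y b) * r b" using diff[OF r(1)] unfolding * .
    \<comment> \<open>Subtracting \<open>r b\<close> times the all-ones check leaves the product of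
      \<open>x a - y a\<close> and \<open>r a - r b\<close>; the first factor is odd, hence a unit
      modulo 4.\<close>
    ultimately have "4 dvd ((x a - y a) * r a + (x b - y b) * r b) - ((x a - y a) + (x b - y b)) * r b"
      by (intro dvd_diff dvd_mult2)
    then have "4 dvd (x a - y a) * (r a - r b)" by (simp add: algebra_simps)
    moreover have "odd (x a - y a)" using one(1) lee_dist_parity[of "x a" "y a"] by simp
    then have "coprime ((2::int) ^ 2) (x a - y a)" by (subst coprime_power_left_iff) simp
    ultimately have "4 dvd r a - r b" by (simp add: coprime_dvd_mult_right_iff)
    then show False using r(2) by (simp add: cong_iff_dvd_diff)
  qed
qed

text \<open>Distinct columns and the all-ones row force distance at least 4. The positions
  \<open>a\<close> and \<open>b\<close>, whose columns agree modulo 2, make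
  \<open>2 e_a + 2 e_b\<close> a codeword of Lee weight 4, so the minimum is attained.\<close>

lemma perfect_code_dual:
  assumes t: "t > 0" and n: "n = 2 ^ (t - 1)"
    and ones: "(\<lambda>_. 1) \<in> R"
    and card: "card (quaternary_dual n R) * 2 ^ (t + 1) = 4 ^ n"
    and sep: "\<And>a b. a < n \<Longrightarrow> b < n \<Longrightarrow> a \<noteq> b \<Longrightarrow> \<exists>r\<in>R. \<not> [r a = r b] (mod 4)"
    and ab: "a < n" "b < n" "a \<noteq> b" "\<And>r. r \<in> R \<Longrightarrow> even (r a + r b)"
  shows "quaternary_linear_perfect_code t (quaternary_dual n R)"
proof -
  let ?C = "quaternary_dual n R"
  have n2: "2 * n = 2 ^ t" using t unfolding n by (cases t) auto
  have C: "?C \<subseteq> {..<n} \<rightarrow>\<^sub>E {0..<4}" by (simp add: subset_iff mem_dual_iff)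
  have "(4::nat) ^ n = 2 ^ (2 ^ t)" unfolding n2[symmetric] power_mult by simp
  \<comment> \<open>The subtraction does not truncate, since \<open>t < 2 ^ t\<close>.\<close>
  moreover have "2 ^ t = 2 ^ t - t - 1 + (t + 1)" using less_exp[of t] by linarith
  then have "(2::nat) ^ 2 ^ t = 2 ^ (2 ^ t - t - 1) * 2 ^ (t + 1)" by (metis power_add)
  ultimately have "card ?C * 2 ^ (t + 1) = 2 ^ (2 ^ t - t - 1) * 2 ^ (t + 1)" using card by metis
  then have cardC: "card (gray_map n ` ?C) = 2 ^ (2 ^ t - t - 1)"
    by (simp add: card_image inj_on_subset[OF inj_on_gray_map C])
  let ?D = "{hamming_dist (2 * n) x y |x y. x \<in> gray_map n ` ?C \<and> y \<in> gray_map n ` ?C \<and> x \<noteq> y}"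
  have fin: "finite ?D"
    by (rule finite_subset[of _ "(\<lambda>(x, y). hamming_dist (2 * n) x y) ` (gray_map n ` ?C \<times> gray_map n ` ?C)"])
      (auto intro!: finite_imageI finite_SigmaI finite_dual)
  have ge: "4 \<le> d" if "d \<in> ?D" for d
  proof -
    from that obtain x y where d: "d = hamming_dist (2 * n) (gray_map n x) (gray_map n y)"
      and xy: "x \<in> ?C" "y \<in> ?C" and "gray_map n x \<noteq> gray_map n y" by auto
    then have "x \<noteq> y" by auto
    then show ?thesis
      unfolding d hamming_dist_gray[OF subsetD[OF C xy(1)] subsetD[OF C xy(2)]]
      by (rule lee_dist_dual_ge[OF xy _ ones sep])
  qed
  have four: "4 \<in> ?D"
  proof -
    let ?f = "\<lambda>j. if j = a \<or> j = b then 2 else (0::int)"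
    define x where "x = (\<lambda>j\<in>{..<n}. (\<lambda>_. 0) j mod (4::int))"
    define y where "y = (\<lambda>j\<in>{..<n}. ?f j mod 4)"
    have supp: "{..<n} \<inter> {j. j = a \<or> j = b} = {a, b}" using ab by auto
    have "(\<Sum>j<n. ?f j * r j) = 2 * (r a + r b)" for r
    proof -
      have "(\<Sum>j<n. ?f j * r j) = (\<Sum>j<n. if j = a \<or> j = b then 2 * r j else 0)"
        by (intro sum.cong) auto
      also have "\<dots> = (\<Sum>j\<in>{a, b}. 2 * r j)" by (simp add: sum.If_cases supp)
      finally show ?thesis using ab by simp
    qed
    moreover have "4 dvd 2 * (r a + r b)" if "r \<in> R" for r
      using mult_dvd_mono[OF dvd_refl[of 2] ab(4)[OF that]] by simp
    ultimately have y: "y \<in> ?C" unfolding y_def reduced_mem_dual_iff by simp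
    have x: "x \<in> ?C" unfolding x_def reduced_mem_dual_iff by simp
    have "x \<in> {..<n} \<rightarrow>\<^sub>E {0..<4}" "y \<in> {..<n} \<rightarrow>\<^sub>E {0..<4}" using x y C by auto
    then have "hamming_dist (2 * n) (gray_map n x) (gray_map n y) = (\<Sum>j<n. lee_dist (x j) (y j))"
      by (rule hamming_dist_gray)
    also have "\<dots> = (\<Sum>j<n. if j = a \<or> j = b then 2 else 0)"
      by (intro sum.cong) (auto simp: x_def y_def lee_dist_def)
    also have "\<dots> = 4" using ab(3) by (simp add: sum.If_cases supp)
    finally have "hamming_dist (2 * n) (gray_map n x) (gray_map n y) = 4" .
    moreover from this have "gray_map n x \<noteq> gray_map n y" by (auto simp: hamming_dist_def)
    ultimately show ?thesis
      using x y by (intro CollectI exI[of _ "gray_map n x"] exI[of _ "gray_map n y"]) simp_all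
  qed
  have "min_distance (2 ^ t) (gray_map n ` ?C) = 4"
    unfolding min_distance_def n2[symmetric] by (rule Min_eqI[OF fin ge four])
  moreover have "gray_map n ` ?C \<subseteq> carrier (Z_vec 2 (2 ^ t))"
    unfolding n2[symmetric] by (intro image_subsetI gray_map_in_carrier)
  moreover have "(\<lambda>j\<in>{..<n}. 1) \<in> quaternary_dual n ?C"
    unfolding mem_dual_iff
  proof (intro conjI ballI)
    fix v assume "v \<in> ?C"
    then have "\<forall>r\<in>R. 4 dvd (\<Sum>j<n. v j * r j)" by (simp add: mem_dual_iff)
    from bspec[OF this ones] show "4 dvd (\<Sum>j<n. (\<lambda>j\<in>{..<n}. 1) j * v j)" by simp
  qed auto
  ultimately show ?thesis
    unfolding quaternary_linear_perfect_code_def extended_perfect_parameters_def n[symmetric]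
    using subgroup_dual cardC by simp
qed

section \<open>Binary columns\<close>

lemma sum_of_bool_eq_mult:
  fixes r :: "nat \<Rightarrow> int"
  assumes "a < n"
  shows "(\<Sum>j<n. of_bool (j = a) * r j) = r a"
proof -
  have "(\<Sum>j<n. of_bool (j = a) * r j) = (\<Sum>j<n. if j = a then r j else 0)"
    by (intro sum.cong) auto
  then show ?thesis using assms by simp
qed

text \<open>Points of the binary space are naturals below \<open>2 ^ m\<close>, read by their
  digits; column \<open>j\<close> carries the point \<open>\<pi> j\<close>. The factor 2 embeds the
  two-element group into the integers modulo 4.\<close>

definition bit_row :: "(nat \<Rightarrow> nat) \<Rightarrow> nat \<Rightarrow> nat \<Rightarrow> int" where
  "bit_row \<pi> i j = 2 * of_bool (bit (\<pi> j) i)"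

definition bit_rows :: "(nat \<Rightarrow> nat) \<Rightarrow> nat \<Rightarrow> (nat \<Rightarrow> int) set" where
  "bit_rows \<pi> k = bit_row \<pi> ` {..<k}"

lemma bit_rows_0: "bit_rows \<pi> 0 = {}"
  by (simp add: bit_rows_def)

lemma bit_rows_Suc: "bit_rows \<pi> (Suc k) = insert (bit_row \<pi> k) (bit_rows \<pi> k)"
  by (simp add: bit_rows_def lessThan_Suc)

lemma less_exp_iff_bit: "x < 2 ^ m \<longleftrightarrow> (\<forall>k. bit x k \<longrightarrow> k < m)" for x :: nat
proof
  assume "x < 2 ^ m"
  then show "\<forall>k. bit x k \<longrightarrow> k < m" by (metis bit_take_bit_iff take_bit_nat_eq_self)
next
  assume "\<forall>k. bit x k \<longrightarrow> k < m"
  then have "take_bit m x = x" by (intro bit_eqI) (auto simp: bit_take_bit_iff)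
  then show "x < 2 ^ m" by (metis take_bit_nat_less_exp)
qed

lemma bit_exp_nat_iff: "bit (2 ^ i :: nat) k \<longleftrightarrow> k = i"
  by (auto simp: bit_exp_iff)

lemma card_dual_ones:
  assumes "n > 0"
  shows "card (quaternary_dual n {\<lambda>_. 1}) * 4 = 4 ^ n"
proof -
  have "card (quaternary_dual n {\<lambda>_. 1}) * 4 = card (quaternary_dual n {})"
    by (rule card_dual_insert[where g = 1 and w = "\<lambda>j. of_bool (j = 0)"])
      (use assms in \<open>simp_all add: sum_of_bool_eq_mult[of 0 n "\<lambda>_. 1", simplified]\<close>)
  then show ?thesis by (simp add: card_dual_empty)
qed

lemma permutes_obtain:
  assumes "\<pi> permutes S" and "y \<in> S"
  obtains x where "x \<in> S" and "\<pi> x = y"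
  using assms by (metis imageE permutes_image)

text \<open>The all-ones row has index 4 and each bit row index 2: the difference of the unit
  vectors at the columns carrying \<open>2 ^ k\<close> and 0 passes all earlier checks and takes the
  value 2 on row \<open>k\<close>.\<close>

lemma card_dual_bit_rows:
  assumes \<pi>: "\<pi> permutes {..<2 ^ m}" and "k \<le> m"
  shows "card (quaternary_dual (2 ^ m) (insert (\<lambda>_. 1) (bit_rows \<pi> k))) * 2 ^ (k + 2) = 4 ^ 2 ^ m"
  using \<open>k \<le> m\<close>
proof (induction k)
  case 0
  then show ?case using card_dual_ones[of "2 ^ m"] by (simp add: bit_rows_0)
next
  case (Suc k)
  let ?n = "2 ^ m :: nat" and ?R = "insert (\<lambda>_. 1) (bit_rows \<pi> k)"
  have "(2::nat) ^ k < 2 ^ m" using Suc.prems by simp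
  then obtain a where a: "a < ?n" "\<pi> a = 2 ^ k" using permutes_obtain[OF \<pi>, of "2 ^ k"] by auto
  obtain b where b: "b < ?n" "\<pi> b = 0" using permutes_obtain[OF \<pi>, of 0] by auto
  let ?w = "\<lambda>j. of_bool (j = a) - of_bool (j = b) :: int"
  have w: "(\<Sum>j<?n. ?w j * r j) = r a - r b" for r
    using a b by (simp add: left_diff_distrib sum_subtractf sum_of_bool_eq_mult)
  have "card (quaternary_dual ?n (insert (bit_row \<pi> k) ?R)) * 2 = card (quaternary_dual ?n ?R)"
    by (rule card_dual_insert[where g = 2 and w = ?w])
      (auto simp: w a b bit_row_def bit_rows_def bit_exp_nat_iff cong_def)
  moreover have "insert (\<lambda>_. 1) (bit_rows \<pi> (Suc k)) = insert (bit_row \<pi> k) ?R"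
    by (simp add: bit_rows_Suc insert_commute)
  moreover have "x * 2 ^ (Suc k + 2) = x * 2 * 2 ^ (k + 2)" for x :: nat by simp
  ultimately show ?case using Suc by (simp only:)
qed

lemma perfect_code_bit_rows:
  assumes \<pi>: "\<pi> permutes {..<2 ^ m}" and "m > 0"
  shows "quaternary_linear_perfect_code (Suc m)
    (quaternary_dual (2 ^ m) (insert (\<lambda>_. 1) (bit_rows \<pi> m)))"
\<comment> \<open>Any two positions serve here, because each row is constant modulo 2.\<close>
proof (rule perfect_code_dual[where a = 0 and b = 1])
  show "card (quaternary_dual (2 ^ m) (insert (\<lambda>_. 1) (bit_rows \<pi> m))) * 2 ^ (Suc m + 1) = 4 ^ 2 ^ m"
    using card_dual_bit_rows[OF \<pi>, of m] by simp
  show "(1 :: nat) < 2 ^ m" using \<open>m > 0\<close> by (intro one_less_power) auto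
  fix a b :: nat assume ab: "a < 2 ^ m" "b < 2 ^ m" "a \<noteq> b"
  then have "\<pi> a \<noteq> \<pi> b" using permutes_inj[OF \<pi>] by (simp add: inj_eq)
  then obtain i where i: "bit (\<pi> a) i \<noteq> bit (\<pi> b) i" by (auto simp: bit_eq_iff)
  have "\<pi> a < 2 ^ m" "\<pi> b < 2 ^ m" using ab permutes_in_image[OF \<pi>] by auto
  then have "i < m" using i by (auto simp: less_exp_iff_bit)
  then have "bit_row \<pi> i \<in> bit_rows \<pi> m" by (simp add: bit_rows_def)
  moreover have "\<not> [bit_row \<pi> i a = bit_row \<pi> i b] (mod 4)"
    using i by (auto simp: bit_row_def cong_def)
  ultimately show "\<exists>r\<in>insert (\<lambda>_. 1) (bit_rows \<pi> m). \<not> [r a = r b] (mod 4)" by blast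
qed (use \<open>m > 0\<close> in \<open>auto simp: bit_rows_def bit_row_def\<close>)

text \<open>The permutation is the cycle \<open>(0 2\<^sup>0 2\<^sup>1 \<dots> 2\<^sup>s\<^sup>-\<^sup>1)\<close>; \<open>z s\<close> below is the preimage of 0.\<close>

lemma cycle_exists:
  assumes "s \<le> m"
  obtains \<pi> :: "nat \<Rightarrow> nat" where "\<pi> permutes {..<2 ^ m}"
    and "\<And>j. j \<noteq> 0 \<Longrightarrow> (\<And>i. i < s \<Longrightarrow> j \<noteq> 2 ^ i) \<Longrightarrow> \<pi> j = j"
    and "\<And>i k. i < s \<Longrightarrow> k \<le> i \<Longrightarrow> \<not> bit (\<pi> (2 ^ i)) k"
    and "\<And>j k. s \<le> k \<Longrightarrow> bit (\<pi> j) k = bit j k"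
proof -
  define z where "z s = (if s = 0 then 0 else 2 ^ (s - 1) :: nat)" for s
  have "\<exists>\<pi>. \<pi> permutes {..<2 ^ m} \<and> \<pi> (z s) = 0 \<and>
      (\<forall>j. j \<noteq> 0 \<longrightarrow> (\<forall>i<s. j \<noteq> 2 ^ i) \<longrightarrow> \<pi> j = j) \<and>
      (\<forall>i k. i < s \<longrightarrow> k \<le> i \<longrightarrow> \<not> bit (\<pi> (2 ^ i)) k) \<and>
      (\<forall>j k. s \<le> k \<longrightarrow> bit (\<pi> j) k = bit j k)"
    using assms
  proof (induction s)
    case 0
    show ?case by (rule exI[of _ id]) (use permutes_id in \<open>simp add: z_def id_def\<close>)
  next
    case (Suc s)
    then obtain \<pi> where \<pi>: "\<pi> permutes {..<2 ^ m}" and z0: "\<pi> (z s) = 0"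
      and fixed: "\<And>j. j \<noteq> 0 \<Longrightarrow> (\<forall>i<s. j \<noteq> 2 ^ i) \<Longrightarrow> \<pi> j = j"
      and low: "\<And>i k. i < s \<Longrightarrow> k \<le> i \<Longrightarrow> \<not> bit (\<pi> (2 ^ i)) k"
      and high: "\<And>j k. s \<le> k \<Longrightarrow> bit (\<pi> j) k = bit j k" by auto
    \<comment> \<open>Precomposing with this transposition lengthens the cycle: \<open>z s\<close>
      now goes to \<open>2 ^ s\<close>, and \<open>2 ^ s\<close> goes to 0.\<close>
    let ?\<tau> = "transpose (z s) (2 ^ s)"
    have zs: "z s \<noteq> 2 ^ s" "z (Suc s) = 2 ^ s" by (auto simp: z_def)
    have new: "\<pi> (2 ^ s) = 2 ^ s" by (rule fixed) auto
    have "z s < 2 ^ m" "(2::nat) ^ s < 2 ^ m"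
      using Suc.prems by (auto simp: z_def intro!: power_strict_increasing)
    then have "\<pi> \<circ> ?\<tau> permutes {..<2 ^ m}"
      using \<pi> by (intro permutes_compose permutes_swap_id) auto
    moreover have "(\<pi> \<circ> ?\<tau>) (z (Suc s)) = 0" using z0 by (simp add: zs)
    moreover have "(\<pi> \<circ> ?\<tau>) j = j" if "j \<noteq> 0" "\<forall>i<Suc s. j \<noteq> 2 ^ i" for j
    proof -
      have "j \<noteq> z s" "j \<noteq> 2 ^ s" using that by (auto simp: z_def)
      then show ?thesis using that fixed by (simp add: transpose_apply_other)
    qed
    moreover have "\<not> bit ((\<pi> \<circ> ?\<tau>) (2 ^ i)) k" if "i < Suc s" "k \<le> i" for i k
    proof (cases "i = s")
      case True
      then show ?thesis by (simp add: z0)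
    next
      case False
      then have "i < s" using that by simp
      show ?thesis
      proof (cases "(2::nat) ^ i = z s")
        case True
        then show ?thesis using \<open>i < s\<close> that by (simp add: new bit_exp_nat_iff)
      next
        case False
        then show ?thesis using \<open>i < s\<close> that low by (simp add: transpose_apply_other)
      qed
    qed
    moreover have "bit ((\<pi> \<circ> ?\<tau>) j) k = bit j k" if "Suc s \<le> k" for j k
    proof -
      have "bit (?\<tau> j) k = bit j k"
        using that by (auto simp: transpose_def z_def bit_exp_nat_iff bit_Suc_0_iff)
      then show ?thesis using high[of k "?\<tau> j"] that by simp
    qed
    ultimately show ?case by blast
  qed
  then show ?thesis using that by blast
qed

text \<open>For \<open>i < s\<close>, the alternating sum over the 2-flat \<open>e\<^sub>i + \<langle>e\<^sub>j, e\<^sub>k\<rangle>\<close> annihilates all rows of the first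
  code; \<open>e\<^sub>i\<close> is the only point of the flat that \<open>\<pi>\<close> moves.\<close>

lemma card_dual_bit_rows_Un:
  assumes fixed: "\<And>j. j \<noteq> 0 \<Longrightarrow> (\<And>i. i < s \<Longrightarrow> j \<noteq> 2 ^ i) \<Longrightarrow> \<pi> j = j"
    and low: "\<And>i k. i < s \<Longrightarrow> k \<le> i \<Longrightarrow> \<not> bit (\<pi> (2 ^ i)) k"
    and "s \<le> m" and m: "s = 0 \<or> 3 \<le> m" and "k \<le> s"
  shows "card (quaternary_dual (2 ^ m) (insert (\<lambda>_. 1) (bit_rows id m \<union> bit_rows \<pi> k))) * 2 ^ (k + m + 2)
    = 4 ^ 2 ^ m"
  using \<open>k \<le> s\<close>
proof (induction k)
  case 0
  then show ?case using card_dual_bit_rows[OF permutes_id, of m m] by (simp only: bit_rows_0 Un_empty_right add_0)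
next
  case (Suc i)
  let ?n = "2 ^ m :: nat" and ?R = "insert (\<lambda>_. 1) (bit_rows id m \<union> bit_rows \<pi> i)"
  have i: "i < s" "i < m" and m3: "3 \<le> m" using Suc.prems \<open>s \<le> m\<close> m by auto
  \<comment> \<open>The flat needs two directions other than \<open>i\<close>, hence
    \<open>3 \<le> m\<close>.\<close>
  obtain j k where jk: "j < m" "k < m" "j \<noteq> i" "k \<noteq> i" "j \<noteq> k"
  proof -
    have "i = 0 \<or> i = 1 \<or> 2 \<le> i" by arith
    then show ?thesis using that[of 1 2] that[of 0 2] that[of 0 1] m3 by auto
  qed
  \<comment> \<open>The four points run around the flat, so alternating signs cancel every
    coordinate.\<close>
  define a b c d :: nat where "a = 2 ^ i" and "b = or (2 ^ i) (2 ^ j)"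
    and "c = or (2 ^ i) (or (2 ^ j) (2 ^ k))" and "d = or (2 ^ i) (2 ^ k)"
  have bits: "bit a l \<longleftrightarrow> l = i" "bit b l \<longleftrightarrow> l = i \<or> l = j" "bit c l \<longleftrightarrow> l = i \<or> l = j \<or> l = k"
    "bit d l \<longleftrightarrow> l = i \<or> l = k" for l
    by (auto simp: a_def b_def c_def d_def bit_or_iff bit_exp_nat_iff)
  have lt: "a < ?n" "b < ?n" "c < ?n" "d < ?n" using i jk by (auto simp: less_exp_iff_bit bits)
  have not_exp: "x \<noteq> 2 ^ q" "x \<noteq> 0" if "bit x i" "bit x p" "p \<noteq> i" for x p q :: nat
    using that by (auto simp: bit_exp_nat_iff intro!: gr0I)
  have \<pi>: "\<pi> b = b" "\<pi> c = c" "\<pi> d = d"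
    by (intro fixed not_exp[of _ j] not_exp[of _ k]; simp add: bits jk)+
  let ?w = "\<lambda>x. of_bool (x = a) - of_bool (x = b) + (of_bool (x = c) - of_bool (x = d)) :: int"
  have w: "(\<Sum>x<?n. ?w x * r x) = r a - r b + (r c - r d)" for r
    using lt by (simp add: left_diff_distrib distrib_right sum_subtractf sum.distrib sum_of_bool_eq_mult)
  have id0: "bit_row id l a - bit_row id l b + (bit_row id l c - bit_row id l d) = 0" for l
    using jk by (auto simp: bit_row_def bits)
  \<comment> \<open>Only the term at \<open>a\<close> changes when \<open>id\<close> is replaced by
    \<open>\<pi>\<close>, and its new value is 0. The result vanishes for \<open>l < i\<close> and
    is -2, that is 2 modulo 4, for \<open>l = i\<close>.\<close>
  have \<pi>0: "bit_row \<pi> l a - bit_row \<pi> l b + (bit_row \<pi> l c - bit_row \<pi> l d) = - bit_row id l a"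
    if "l \<le> i" for l
    using id0[of l] low[OF i(1) that] by (simp add: bit_row_def \<pi> a_def)
  have "card (quaternary_dual ?n (insert (bit_row \<pi> i) ?R)) * 2 = card (quaternary_dual ?n ?R)"
  proof (rule card_dual_insert[where g = 2 and w = ?w], unfold w)
    fix r assume "r \<in> ?R"
    then consider "r = (\<lambda>_. 1)" | l where "r = bit_row id l" | l where "r = bit_row \<pi> l" "l < i"
      by (auto simp: bit_rows_def)
    then show "4 dvd r a - r b + (r c - r d)"
    proof cases
      case 3
      then show ?thesis using \<pi>0[of l] by (simp add: bit_row_def bits)
    qed (simp_all add: id0)
  next
    show "[bit_row \<pi> i a - bit_row \<pi> i b + (bit_row \<pi> i c - bit_row \<pi> i d) = int 2] (mod 4)"
      unfolding \<pi>0[OF order_refl] by (simp add: bit_row_def bits cong_def)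
  qed (simp_all add: bit_row_def)
  moreover have "insert (\<lambda>_. 1) (bit_rows id m \<union> bit_rows \<pi> (Suc i)) = insert (bit_row \<pi> i) ?R"
    by (simp add: bit_rows_Suc insert_commute)
  moreover have "x * 2 ^ (Suc i + m + 2) = x * 2 * 2 ^ (i + m + 2)" for x :: nat by simp
  ultimately show ?case using Suc by (simp only:)
qed

text \<open>Sizes are carried as products with a power of 2, so truncated subtraction is met only
  here.\<close>

lemma exp_eq_if_mult_exp_eq:
  fixes c l n :: nat
  assumes "c * 2 ^ l = 4 ^ n" and "l \<le> 2 * n"
  shows "c = 2 ^ (2 * n - l)"
proof -
  have "(4::nat) ^ n = 2 ^ (2 * n)" by (simp add: power_mult)
  also have "\<dots> = 2 ^ (2 * n - l) * 2 ^ l" using assms(2) by (simp flip: power_add)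
  finally show ?thesis using assms(1) by simp
qed

text \<open>Since \<open>\<pi>\<close> preserves all bits from position \<open>s\<close> on, the
  second code adds only \<open>s\<close> new rows to the first, each halving the
  intersection.\<close>

lemma intersection_binary:
  assumes "0 < m" and "s \<le> m" and "s = 0 \<or> 3 \<le> m"
  shows "\<exists>C\<^sub>1 C\<^sub>2. quaternary_linear_perfect_code (Suc m) C\<^sub>1 \<and>
    quaternary_linear_perfect_code (Suc m) C\<^sub>2 \<and>
    intersection_number C\<^sub>1 C\<^sub>2 * 2 ^ (s + m + 2) = 4 ^ 2 ^ m"
proof -
  obtain \<pi> :: "nat \<Rightarrow> nat" where \<pi>: "\<pi> permutes {..<2 ^ m}"
    and fixed: "\<And>j. j \<noteq> 0 \<Longrightarrow> (\<And>i. i < s \<Longrightarrow> j \<noteq> 2 ^ i) \<Longrightarrow> \<pi> j = j"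
    and low: "\<And>i k. i < s \<Longrightarrow> k \<le> i \<Longrightarrow> \<not> bit (\<pi> (2 ^ i)) k"
    and high: "\<And>j k. s \<le> k \<Longrightarrow> bit (\<pi> j) k = bit j k"
    using cycle_exists[OF \<open>s \<le> m\<close>] by metis
  let ?C = "\<lambda>\<pi>. quaternary_dual (2 ^ m) (insert (\<lambda>_. 1) (bit_rows \<pi> m))"
  have "bit_row \<pi> i = bit_row id i" if "s \<le> i" for i
    using high[OF that] by (simp add: fun_eq_iff bit_row_def)
  then have "bit_rows \<pi> m \<subseteq> bit_rows id m \<union> bit_rows \<pi> s"
    unfolding bit_rows_def by (smt (verit) UnCI imageE image_eqI lessThan_iff linorder_not_le subsetI)
  moreover have "bit_rows \<pi> s \<subseteq> bit_rows \<pi> m" using \<open>s \<le> m\<close> by (auto simp: bit_rows_def)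
  ultimately have "insert (\<lambda>_. 1) (bit_rows id m) \<union> insert (\<lambda>_. 1) (bit_rows \<pi> m) =
      insert (\<lambda>_. 1) (bit_rows id m \<union> bit_rows \<pi> s)" by blast
  then have "intersection_number (?C id) (?C \<pi>) * 2 ^ (s + m + 2) = 4 ^ 2 ^ m"
    unfolding intersection_number_def dual_Un[symmetric]
    using card_dual_bit_rows_Un[OF fixed low assms(2,3) order_refl] by simp
  then show ?thesis
    using perfect_code_bit_rows[OF \<pi> \<open>0 < m\<close>] perfect_code_bit_rows[OF permutes_id \<open>0 < m\<close>] by blast
qed

section \<open>Length four\<close>

text \<open>The column group is now cyclic of order 4, so a single row of residues replaces the two
  bit rows.\<close>

definition Z4_rows :: "(nat \<Rightarrow> nat) \<Rightarrow> (nat \<Rightarrow> int) set" where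
  "Z4_rows \<pi> = {\<lambda>j. int (\<pi> j), \<lambda>_. 1}"

lemma card_dual_Z4_rows:
  assumes \<pi>: "\<pi> permutes {..<4}"
  shows "card (quaternary_dual 4 (Z4_rows \<pi>)) * 2 ^ 4 = 4 ^ 4"
proof -
  obtain a where a: "a < 4" "\<pi> a = 1" using permutes_obtain[OF \<pi>, of 1] by auto
  obtain b where b: "b < 4" "\<pi> b = 0" using permutes_obtain[OF \<pi>, of 0] by auto
  let ?w = "\<lambda>j. of_bool (j = a) - of_bool (j = b) :: int"
  have w: "(\<Sum>j<4. ?w j * r j) = r a - r b" for r
    using a b by (simp only: left_diff_distrib sum_subtractf sum_of_bool_eq_mult)
  have "card (quaternary_dual 4 (Z4_rows \<pi>)) * 4 = card (quaternary_dual 4 {\<lambda>_. 1})"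
    unfolding Z4_rows_def
    by (rule card_dual_insert[where g = 1 and w = ?w], unfold w) (use a b in simp_all)
  then show ?thesis using card_dual_ones[of 4] by simp
qed

lemma perfect_code_Z4_rows:
  assumes \<pi>: "\<pi> permutes {..<4}"
  shows "quaternary_linear_perfect_code 3 (quaternary_dual 4 (Z4_rows \<pi>))"
proof -
  \<comment> \<open>The columns carrying 0 and 2 agree modulo 2, as the word of Lee weight 4
    requires.\<close>
  obtain a where a: "a < 4" "\<pi> a = 2" using permutes_obtain[OF \<pi>, of 2] by auto
  obtain b where b: "b < 4" "\<pi> b = 0" using permutes_obtain[OF \<pi>, of 0] by auto
  show ?thesis
  proof (rule perfect_code_dual[where a = a and b = b])
    show "card (quaternary_dual 4 (Z4_rows \<pi>)) * 2 ^ (3 + 1) = 4 ^ 4"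
      using card_dual_Z4_rows[OF \<pi>] by simp
    fix x y :: nat assume xy: "x < 4" "y < 4" "x \<noteq> y"
    then have "\<pi> x \<noteq> \<pi> y" using permutes_inj[OF \<pi>] by (simp add: inj_eq)
    moreover have "\<pi> x < 4" "\<pi> y < 4" using xy permutes_in_image[OF \<pi>] by auto
    ultimately have "\<not> [int (\<pi> x) = int (\<pi> y)] (mod 4)" by (simp add: cong_def)
    then show "\<exists>r\<in>Z4_rows \<pi>. \<not> [r x = r y] (mod 4)" by (simp add: Z4_rows_def)
  qed (use a b in \<open>auto simp: Z4_rows_def\<close>)
qed

lemma sum_lessThan_4: "(\<Sum>j<4. f j) = f 0 + f 1 + f 2 + f 3" for f :: "nat \<Rightarrow> int"
  by (simp add: eval_nat_numeral)

text \<open>Bit row 0 is twice the residue row modulo 4, so only bit row 1 is new, and it halves the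
  first code. The witness (1,2,1,0) lies in that code and takes the value 2 on the new row.\<close>

lemma intersection_length_4_mixed:
  "intersection_number (quaternary_dual 4 (Z4_rows id))
     (quaternary_dual 4 (insert (\<lambda>_. 1) (bit_rows id 2))) * 2 ^ 5 = 4 ^ 4"
proof -
  have rows: "bit_rows id 2 = {bit_row id 0, bit_row id 1}"
    by (simp add: bit_rows_Suc bit_rows_0 numeral_2_eq_2 insert_commute)
  have row0: "(\<Sum>j<4. v j * bit_row id 0 j) = 2 * v 1 + 2 * v 3" for v
    by (simp add: sum_lessThan_4 bit_row_def bit_0)
  have *: "4 dvd 2 * v 1 + 2 * v 3" if "4 dvd (\<Sum>j<4. v j * int j)" for v :: "nat \<Rightarrow> int"
    using that by (simp add: sum_lessThan_4) presburger
  have "quaternary_dual 4 (Z4_rows id) \<inter> quaternary_dual 4 (insert (\<lambda>_. 1) (bit_rows id 2)) =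
      quaternary_dual 4 (insert (bit_row id 1) (Z4_rows id))"
  proof (rule Set.set_eqI)
    fix v
    show "v \<in> quaternary_dual 4 (Z4_rows id) \<inter> quaternary_dual 4 (insert (\<lambda>_. 1) (bit_rows id 2)) \<longleftrightarrow>
        v \<in> quaternary_dual 4 (insert (bit_row id 1) (Z4_rows id))"
      unfolding rows Z4_rows_def Int_iff mem_dual_iff using *[of v]
      by (simp only: ball_simps row0 id_apply) blast
  qed
  moreover have "card (quaternary_dual 4 (insert (bit_row id 1) (Z4_rows id))) * 2 =
      card (quaternary_dual 4 (Z4_rows id))"
    by (rule card_dual_insert[where g = 2 and w = "\<lambda>j. of_bool (j = 0) + 2 * of_bool (j = 1) + of_bool (j = 2)"])
      (auto simp: bit_row_def Z4_rows_def sum_lessThan_4 cong_def bit_iff_odd)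
  ultimately show ?thesis
    using card_dual_Z4_rows[OF permutes_id] by (simp add: intersection_number_def)
qed

text \<open>The swapped row is (0,1,3,2). The codeword (1,2,1,0) of the first code evaluates on it
  to 5, a generator modulo 4, so the index is 4.\<close>

lemma intersection_length_4_Z4:
  "intersection_number (quaternary_dual 4 (Z4_rows id)) (quaternary_dual 4 (Z4_rows (transpose 2 3)))
     * 2 ^ 6 = 4 ^ 4"
proof -
  let ?r = "\<lambda>j. int (transpose 2 3 j)"
  have "Z4_rows id \<union> Z4_rows (transpose 2 3) = insert ?r (Z4_rows id)"
    by (auto simp: Z4_rows_def)
  moreover have "card (quaternary_dual 4 (insert ?r (Z4_rows id))) * 4 = card (quaternary_dual 4 (Z4_rows id))"
    by (rule card_dual_insert[where g = 1 and w = "\<lambda>j. of_bool (j = 0) + 2 * of_bool (j = 1) + of_bool (j = 2)"])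
      (auto simp: Z4_rows_def sum_lessThan_4 cong_def transpose_def)
  ultimately show ?thesis
    using card_dual_Z4_rows[OF permutes_id] by (simp add: intersection_number_def flip: dual_Un)
qed

theorem theorem5:
  fixes t \<beta> l :: nat
  assumes "t \<ge> 3" and "\<beta> = 2 ^ (t - 1)" and "t + 1 \<le> l" and "l \<le> 2 * t"
  shows "\<exists>C\<^sub>1 C\<^sub>2. quaternary_linear_perfect_code t C\<^sub>1 \<and> quaternary_linear_perfect_code t C\<^sub>2 \<and>
           intersection_number C\<^sub>1 C\<^sub>2 = 2 ^ (2 * \<beta> - l)"
proof -
  have "t \<le> \<beta>" using assms(1) less_exp[of "t - 1"] unfolding assms(2) by linarith
  then have l: "l \<le> 2 * \<beta>" using assms(4) by linarith
  have "\<exists>C\<^sub>1 C\<^sub>2. quaternary_linear_perfect_code t C\<^sub>1 \<and> quaternary_linear_perfect_code t C\<^sub>2 \<and>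
      intersection_number C\<^sub>1 C\<^sub>2 * 2 ^ l = 4 ^ \<beta>"
  proof (cases "l = t + 1 \<or> 4 \<le> t")
    case True
    \<comment> \<open>\<open>s\<close> counts the checks beyond the \<open>t + 1\<close> binary
      factors of one code; \<open>l \<le> 2 * t\<close> gives \<open>s \<le> m\<close>.\<close>
    define m s where "m = t - 1" and "s = l - (t + 1)"
    have "0 < m" "s \<le> m" "s = 0 \<or> 3 \<le> m" "Suc m = t" "s + m + 2 = l" "\<beta> = 2 ^ m"
      using True assms by (auto simp: m_def s_def)
    then show ?thesis using intersection_binary[of m s] by metis
  next
    case False
    then have "t = 3" using assms(1) by linarith
    then have t: "t = 3" "\<beta> = 4" and "l = 5 \<or> l = 6" using False assms by auto
    have swap: "transpose 2 3 permutes {..<4 :: nat}" by (rule permutes_swap_id) auto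
    \<comment> \<open>This binary code is paired with a cyclic one for \<open>l = 5\<close>; two
      cyclic ones give \<open>l = 6\<close>.\<close>
    have "quaternary_linear_perfect_code 3 (quaternary_dual 4 (insert (\<lambda>_. 1) (bit_rows id 2)))"
      using perfect_code_bit_rows[OF permutes_id, of 2] by simp
    then show ?thesis
      using \<open>l = 5 \<or> l = 6\<close> perfect_code_Z4_rows[OF permutes_id] perfect_code_Z4_rows[OF swap]
        intersection_length_4_mixed intersection_length_4_Z4 unfolding t by metis
  qed
  then show ?thesis using exp_eq_if_mult_exp_eq[OF _ l] by blast
qed

end
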